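(* Let $\mathcal{D}\subset\mathbb{H}$ be open, bounded and connected, let $F:\partial\mathcal{D}\to\mathbb{R}$ be continuous, and let $u^\epsilon(q)=\mathbb{E}[F\circ Q^{\epsilon,q}]$ for $q\in\mathcal{D}$, $\epsilon\in(0,1)$. Assume that for every $\eta>0$ there exist $\delta,\epsilon_0>0$ such that for all $\epsilon\in(0,\epsilon_0)$ there holds $$|u^\epsilon(q')-u^\epsilon(q)|\le\eta\quad\text{for all } q,q'\in\mathcal{D}\ \text{ satisfying } d(q,\partial\mathcal{D})<\delta,\ |q-q'|\le\delta.$$ Then for every $\eta>0$ there exist $\hat\delta,\hat\epsilon>0$ such that for all $\epsilon\in(0,\hat\epsilon)$ and all $q,q'\in\mathcal{D}$ satisfying $|q-q'|\le\hat\delta$, there holds $|u^\epsilon(q')-u^\epsilon(q)|\le\eta$.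
   Context: $\mathbb{H}=(\mathbb{R}^3,* )$ is the first Heisenberg group with $(x,y,z)*(x',y',z')=(x+x',y+y',z+z'+\frac12(xy'-yx'))$. The Korányi gauge is $|(x,y,z)|_K=((x^2+y^2)^2+16z^2)^{1/4}$, the metric is $d(q,q')=|q^{-1}*q'|_K$, $d(q,\partial\mathcal{D})$ is the distance to $\partial\mathcal{D}$ in this metric, $B_r(q)=\{q'\in\mathbb{H}: d(q,q')<r\}$, and $|\cdot|$ is the Euclidean norm. Horizontal $\epsilon$-walk: let $w_1,w_2,\ldots$ be independent random variables, uniformly distributed on the Euclidean unit disc $B_1^2(0)\subset\mathbb{R}^2$ (on the countable product probability space $(\Omega,\mathcal{F},\mathbb{P})$ of the disc with normalized Lebesgue measure). For $q_0\in\mathcal{D}$ and $\epsilon\in(0,1)$ set $Q_0^{\epsilon,q_0}=q_0$ and, writing $w_n=(a_n,b_n)$ and $\lambda_{n-1}=\min\{\epsilon,d(Q^{\epsilon,q_0}_{n-1},\partial\mathcal{D})\}$, $$Q_n^{\epsilon,q_0}=Q_{n-1}^{\epsilon,q_0}*(\lambda_{n-1}a_n,\lambda_{n-1}b_n,0).$$ This sequence is a bounded martingale with values in $\mathcal{D}$, converging almost surely to a random variable $Q^{\epsilon,q_0}$ with values in $\partial\mathcal{D}$. *)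

theory Defs
  imports "HOL-Probability.Probability"
begin

text \<open>The norm of the product type is the Euclidean norm of the three coordinates, and the topology
  of this type is the one induced by the Koranyi metric.\<close>

type_synonym heis = "real \<times> real \<times> real"

fun heis_mult :: "heis \<Rightarrow> heis \<Rightarrow> heis" (infixl \<open>\<odot>\<close> 70) where
  "(x, y, z) \<odot> (x', y', z') = (x + x', y + y', z + z' + (x * y' - y * x') / 2)"

fun heis_inv :: "heis \<Rightarrow> heis" where
  "heis_inv (x, y, z) = (- x, - y, - z)"

lemma heis_mult_assoc: "(p \<odot> q) \<odot> r = p \<odot> (q \<odot> r)"
  by (cases p; cases q; cases r) (simp add: field_simps)

lemma heis_mult_zero [simp]: "0 \<odot> q = q" "q \<odot> 0 = q"
  by (cases q; simp add: zero_prod_def)+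

lemma heis_mult_inv [simp]: "heis_inv q \<odot> q = 0" "q \<odot> heis_inv q = 0"
  by (cases q; simp add: zero_prod_def)+

fun koranyi_gauge :: "heis \<Rightarrow> real" where
  "koranyi_gauge (x, y, z) = ((x\<^sup>2 + y\<^sup>2)\<^sup>2 + 16 * z\<^sup>2) powr (1 / 4)"

definition koranyi_dist :: "heis \<Rightarrow> heis \<Rightarrow> real" where
  "koranyi_dist q q' = koranyi_gauge (heis_inv q \<odot> q')"

definition koranyi_setdist :: "heis \<Rightarrow> heis set \<Rightarrow> real" where
  "koranyi_setdist q S = (INF p\<in>S. koranyi_dist q p)"

definition disc_measure :: "(real \<times> real) measure" where
  "disc_measure = uniform_measure (restrict_space lborel (ball 0 1)) (ball 0 1)"

definition walk_space :: "(nat \<Rightarrow> real \<times> real) measure" where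
  "walk_space = (\<Pi>\<^sub>M i\<in>UNIV. disc_measure)"

lemma prob_space_disc_measure: "prob_space disc_measure"
proof -
  let ?B = "ball (0 :: real \<times> real) 1"
  have "emeasure (restrict_space lborel ?B) ?B = emeasure lborel ?B"
    by (subst emeasure_restrict_space) auto
  moreover have "emeasure lborel ?B \<noteq> 0"
    using content_ball_pos[of 1 "0 :: real \<times> real"]
    by (metis enn2real_0 less_irrefl measure_def zero_less_one)
  moreover have "emeasure lborel ?B \<noteq> \<infinity>"
    using emeasure_lborel_ball_finite[of "0 :: real \<times> real" 1] by simp
  ultimately show ?thesis
    unfolding disc_measure_def by (intro prob_space_uniform_measure) auto
qed

lemma prob_space_walk_space: "prob_space walk_space"
  unfolding walk_space_def by (intro prob_space_PiM prob_space_disc_measure)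

text \<open>The coordinate \<open>w n\<close> is the \<open>(n + 1)\<close>-st step, i.e. \<open>w\<^sub>n\<^sub>+\<^sub>1\<close> when steps are numbered from 1.\<close>

primrec heis_walk ::
  "heis set \<Rightarrow> real \<Rightarrow> heis \<Rightarrow> (nat \<Rightarrow> real \<times> real) \<Rightarrow> nat \<Rightarrow> heis" where
  "heis_walk D \<epsilon> q w 0 = q"
| "heis_walk D \<epsilon> q w (Suc n) =
     (let p = heis_walk D \<epsilon> q w n;
          r = min \<epsilon> (koranyi_setdist p (frontier D))
      in p \<odot> (r * fst (w n), r * snd (w n), 0))"

definition heis_walk_limit ::
  "heis set \<Rightarrow> real \<Rightarrow> heis \<Rightarrow> (nat \<Rightarrow> real \<times> real) \<Rightarrow> heis" where
  "heis_walk_limit D \<epsilon> q w = lim (heis_walk D \<epsilon> q w)"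

text \<open>The boundary function \<open>F\<close> is only meaningful on \<open>frontier D\<close>, where the limit of the walk lies
  almost surely. Its values elsewhere are arbitrary, so on the exceptional null event the integrand
  is set to zero; otherwise a wild \<open>F\<close> could make it non-measurable.\<close>

definition walk_value :: "heis set \<Rightarrow> (heis \<Rightarrow> real) \<Rightarrow> real \<Rightarrow> heis \<Rightarrow> real" where
  "walk_value D F \<epsilon> q =
     (\<integral>w. (if heis_walk_limit D \<epsilon> q w \<in> frontier D then F (heis_walk_limit D \<epsilon> q w) else 0)
        \<partial>walk_space)"

end

theory Submission
  imports Defs
begin

text \<open>Couple the walks from \<open>q\<close> and \<open>q'\<close> by using the same steps: as long as both use the radius \<open>\<epsilon>\<close>,
  the second is the left translate of the first by \<open>c = q' \<odot> heis_inv q\<close>. Instead of stopping the walk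
  near the boundary, note that \<open>u = walk_value D F \<epsilon>\<close> has the one-step mean value property, so
  \<open>v p = u (c \<odot> p) - u p\<close> has it too at points far from \<open>frontier D\<close>, while \<open>\<bar>v\<bar> \<le> \<eta>\<close> near \<open>frontier D\<close>
  by hypothesis. A maximum principle then gives \<open>\<bar>v\<bar> \<le> \<eta>\<close> everywhere: adding a small multiple of a
  bounded function whose one-step average exceeds its value by a fixed amount prevents the supremum
  from being approached in the interior. Convergence of the walk is not needed, and compactness
  replaces the triangle inequality for the Koranyi distance.\<close>

section \<open>Continuity and measurability of the group law and the Koranyi distance\<close>

lemma heis_mult_conv:
  "p \<odot> q = (fst p + fst q, fst (snd p) + fst (snd q),
     snd (snd p) + snd (snd q) + (fst p * fst (snd q) - fst (snd p) * fst q) / 2)"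
  by (cases p; cases q) simp

lemma heis_inv_conv: "heis_inv p = - p"
  by (cases p) simp

lemma koranyi_gauge_conv:
  "koranyi_gauge p = (((fst p)\<^sup>2 + (fst (snd p))\<^sup>2)\<^sup>2 + 16 * (snd (snd p))\<^sup>2) powr (1 / 4)"
  by (cases p) simp

lemma continuous_on_heis_mult [continuous_intros]:
  "continuous_on S f \<Longrightarrow> continuous_on S g \<Longrightarrow> continuous_on S (\<lambda>x. f x \<odot> g x)"
  unfolding heis_mult_conv by (intro continuous_intros) auto

lemma continuous_on_koranyi_dist [continuous_intros]:
  "continuous_on S f \<Longrightarrow> continuous_on S g \<Longrightarrow> continuous_on S (\<lambda>x. koranyi_dist (f x) (g x))"
  unfolding koranyi_dist_def koranyi_gauge_conv heis_mult_conv heis_inv_conv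
  \<comment> \<open>The base of the power may vanish; the positive exponent keeps it continuous
    there.\<close>
  by (intro continuous_on_powr' continuous_intros) auto

lemma koranyi_dist_nonneg: "0 \<le> koranyi_dist p q"
  by (simp add: koranyi_dist_def koranyi_gauge_conv)

lemma koranyi_dist_self [simp]: "koranyi_dist p p = 0"
  by (simp add: koranyi_dist_def zero_prod_def)

lemma bdd_below_koranyi_dist: "bdd_below (koranyi_dist p ` S)"
  by (auto intro!: bdd_belowI2[of _ 0] koranyi_dist_nonneg)

lemma koranyi_setdist_le: "y \<in> S \<Longrightarrow> koranyi_setdist p S \<le> koranyi_dist p y"
  unfolding koranyi_setdist_def by (rule cINF_lower[OF bdd_below_koranyi_dist])

lemma koranyi_setdist_greatest:
  "S \<noteq> {} \<Longrightarrow> (\<And>y. y \<in> S \<Longrightarrow> r \<le> koranyi_dist p y) \<Longrightarrow> r \<le> koranyi_setdist p S"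
  unfolding koranyi_setdist_def by (rule cINF_greatest)

text \<open>The infimum may run over uncountably many points, but its strict sublevel sets are
  unions of open sets, hence open. For empty \<open>S\<close> the function is constant.\<close>

lemma measurable_koranyi_setdist [measurable]:
  "(\<lambda>p. koranyi_setdist p S) \<in> borel_measurable borel"
proof (cases "S = {}")
  case False
  show ?thesis
    unfolding borel_measurable_iff_less
  proof
    fix a :: real
    have "{p \<in> space borel. koranyi_setdist p S < a} = (\<Union>y\<in>S. {p. koranyi_dist p y < a})"
      using False by (auto simp: koranyi_setdist_def cINF_less_iff[OF False bdd_below_koranyi_dist])
    moreover have "open {p. koranyi_dist p y < a}" for y
      by (intro open_Collect_less continuous_intros)
    ultimately show "{p \<in> space borel. koranyi_setdist p S < a} \<in> sets borel"
      by (auto intro!: borel_open open_UN)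
  qed
qed (simp add: koranyi_setdist_def)

lemma measurable_heis_mult [measurable]:
  assumes [measurable]: "f \<in> borel_measurable M" "g \<in> borel_measurable M"
  shows "(\<lambda>x. f x \<odot> g x) \<in> borel_measurable M"
proof -
  have "(\<lambda>(p, q). p \<odot> q) \<in> borel_measurable (borel \<Otimes>\<^sub>M borel)"
    unfolding borel_prod case_prod_beta
    by (intro borel_measurable_continuous_onI continuous_intros)
  from measurable_compose[OF _ this, of "\<lambda>x. (f x, g x)" M] show ?thesis by simp
qed

section \<open>The step distribution on the disc and the walk space\<close>

interpretation disc: prob_space disc_measure
  by (rule prob_space_disc_measure)

interpretation walk: prob_space walk_space
  by (rule prob_space_walk_space)

lemma space_disc_measure: "space disc_measure = ball 0 1"
  by (simp add: disc_measure_def space_restrict_space)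

lemma measurable_disc_borel [measurable]: "(\<lambda>a. a) \<in> borel_measurable disc_measure"
proof -
  have "(\<lambda>a. a) \<in> borel_measurable (restrict_space lborel (ball (0 :: real \<times> real) 1))"
    by (intro measurable_restrict_space1) auto
  then show ?thesis
    by (simp add: disc_measure_def)
qed

lemma measurable_walk_component [measurable]: "(\<lambda>w. w n) \<in> borel_measurable walk_space"
proof -
  have "(\<lambda>w. w n) \<in> measurable walk_space disc_measure"
    unfolding walk_space_def by measurable
  from measurable_compose[OF this measurable_disc_borel] show ?thesis by simp
qed

lemma measurable_fst_disc [measurable]: "fst \<in> borel_measurable disc_measure"
  using measurable_compose[OF measurable_disc_borel, of fst borel] by (simp add: borel_prod[symmetric])

lemma measurable_snd_disc [measurable]: "snd \<in> borel_measurable disc_measure"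
  using measurable_compose[OF measurable_disc_borel, of snd borel] by (simp add: borel_prod[symmetric])

lemma norm_disc_less: "a \<in> space disc_measure \<Longrightarrow> norm a < 1"
  by (simp add: space_disc_measure)

lemma abs_fst_disc_less: "a \<in> space disc_measure \<Longrightarrow> \<bar>fst a\<bar> < 1"
  using norm_disc_less[of a] norm_fst_le[of "fst a" "snd a"] by simp

lemma integrable_disc_bounded:
  fixes f :: "real \<times> real \<Rightarrow> real"
  assumes "f \<in> borel_measurable disc_measure" "\<And>a. a \<in> space disc_measure \<Longrightarrow> \<bar>f a\<bar> \<le> B"
  shows "integrable disc_measure f"
  using assms by (intro disc.integrable_const_bound[of _ B]) auto

text \<open>If the integral vanished, the first coordinate would be zero almost everywhere on the
  disc, although it is positive on an open square inside. This second moment is the strict gain of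
  the barrier in \<open>square_barrier\<close>.\<close>

lemma integral_disc_fst_square_pos: "0 < (\<integral>a. (fst a)\<^sup>2 \<partial>disc_measure)"
proof -
  let ?B = "ball 0 1 :: (real \<times> real) set" and ?C = "{0<..<1/2} \<times> {0<..<1/2} :: (real \<times> real) set"
  have int: "integrable disc_measure (\<lambda>a. (fst a)\<^sup>2)"
    using abs_fst_disc_less
    by (intro integrable_disc_bounded[of _ 1]) (auto simp: abs_square_le_1 less_imp_le)
  have "(\<integral>a. (fst a)\<^sup>2 \<partial>disc_measure) \<noteq> 0"
  proof
    assume "(\<integral>a. (fst a)\<^sup>2 \<partial>disc_measure) = 0"
    then have "AE a in disc_measure. fst a = 0"
      using integral_nonneg_eq_0_iff_AE[OF int] by simp
    moreover have "emeasure (restrict_space lborel ?B) ?B \<noteq> 0" "emeasure (restrict_space lborel ?B) ?B < \<infinity>"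
      using emeasure_lborel_ball_finite[of "0 :: real \<times> real" 1] content_ball_pos[of 1 "0 :: real \<times> real"]
      by (auto simp: emeasure_restrict_space measure_def)
    ultimately have "AE a in restrict_space lborel ?B. a \<in> ?B \<longrightarrow> fst a = 0"
      unfolding disc_measure_def by (simp add: AE_uniform_measure)
    then have "AE a in lborel. a \<in> ?B \<longrightarrow> fst a = 0"
      by (subst (asm) AE_restrict_space_iff) auto
    \<comment> \<open>Points of \<open>?C\<close> have norm below 1/2 + 1/2 and positive first
      coordinate.\<close>
    then have "AE a in lborel. a \<notin> ?C"
    proof (rule AE_mp, intro AE_I2 impI notI)
      fix a :: "real \<times> real" assume *: "a \<in> ?B \<longrightarrow> fst a = 0" "a \<in> ?C"
      then have "norm a \<le> \<bar>fst a\<bar> + \<bar>snd a\<bar>"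
        by (metis norm_Pair_le prod.collapse real_norm_def)
      with * show False by auto
    qed
    then have "?C \<in> null_sets lborel"
      by (subst (asm) AE_iff_null_sets[symmetric]) (auto intro!: borel_open open_Times)
    moreover have "open ?C" "?C \<noteq> {}"
      by (auto intro!: open_Times)
    ultimately show False
      using open_not_negligible[of ?C] negligible_iff_null_sets[of ?C]
      by (metis null_sets_completionI)
  qed
  moreover have "0 \<le> (\<integral>a. (fst a)\<^sup>2 \<partial>disc_measure)"
    by simp
  ultimately show ?thesis by linarith
qed

section \<open>The walk, its limit and the one-step mean value property\<close>

text \<open>Measurability is joint in the starting point and the steps, because the first step
  randomizes the starting point of the remaining walk.\<close>

lemma measurable_heis_walk [measurable]:
  "(\<lambda>x. heis_walk D \<epsilon> (fst x) (snd x) n) \<in> borel_measurable (borel \<Otimes>\<^sub>M walk_space)"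
proof (induction n)
  case (Suc n)
  note [measurable] = Suc measurable_compose[OF measurable_snd measurable_walk_component]
  have [measurable]: "(\<lambda>x. fst (snd x n)) \<in> borel_measurable ((borel :: heis measure) \<Otimes>\<^sub>M walk_space)"
    "(\<lambda>x. snd (snd x n)) \<in> borel_measurable ((borel :: heis measure) \<Otimes>\<^sub>M walk_space)"
    using measurable_compose[OF measurable_compose[OF measurable_snd measurable_walk_component], of _ borel]
    by (auto simp: borel_prod[symmetric])
  show ?case
    by (simp add: Let_def)
qed simp

text \<open>Pathwise Markov property at time one: \<open>case_nat a w\<close> prepends the step
  \<open>a\<close> to \<open>w\<close>, so the walk restarts from its first position with the
  remaining steps.\<close>

lemma heis_walk_case_nat:
  "heis_walk D \<epsilon> q (case_nat a w) (Suc n) =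
   heis_walk D \<epsilon> (q \<odot> (min \<epsilon> (koranyi_setdist q (frontier D)) * fst a,
                       min \<epsilon> (koranyi_setdist q (frontier D)) * snd a, 0)) w n"
  by (induction n) (simp_all add: Let_def)

lemma heis_walk_limit_case_nat:
  "heis_walk_limit D \<epsilon> q (case_nat a w) =
   heis_walk_limit D \<epsilon> (q \<odot> (min \<epsilon> (koranyi_setdist q (frontier D)) * fst a,
                             min \<epsilon> (koranyi_setdist q (frontier D)) * snd a, 0)) w"
proof -
  \<comment> \<open>A sequence and its shift have the same limit points in the description defining
    \<open>lim\<close>, so equality holds for divergent sequences as well.\<close>
  have "lim f = lim (\<lambda>n. f (Suc n))" for f :: "nat \<Rightarrow> heis"
    unfolding lim_def by (simp add: filterlim_sequentially_Suc)
  from this[of "heis_walk D \<epsilon> q (case_nat a w)"] show ?thesis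
    unfolding heis_walk_limit_def heis_walk_case_nat by simp
qed

lemma continuous_on_frontier_bound:
  fixes F :: "'a :: heine_borel \<Rightarrow> real"
  assumes "bounded D" "continuous_on (frontier D) F"
  obtains B where "0 \<le> B" "\<And>y. y \<in> frontier D \<Longrightarrow> \<bar>F y\<bar> \<le> B"
proof -
  have "bounded (F ` frontier D)"
    using assms compact_frontier_bounded[of D]
    by (intro compact_imp_bounded compact_continuous_image)
  then obtain B where "0 < B" "\<forall>y\<in>F ` frontier D. norm y \<le> B"
    by (auto simp: bounded_pos)
  then show ?thesis
    by (intro that[of B]) auto
qed

text \<open>Extending \<open>F\<close> by zero from the closed set \<open>frontier D\<close> gives a
  Borel function, which is then composed with the measurable limit map.\<close>

lemma measurable_walk_integrand [measurable]:
  fixes F :: "heis \<Rightarrow> real"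
  assumes "continuous_on (frontier D) F"
  shows "(\<lambda>x. if heis_walk_limit D \<epsilon> (fst x) (snd x) \<in> frontier D
              then F (heis_walk_limit D \<epsilon> (fst x) (snd x)) else 0)
         \<in> borel_measurable (borel \<Otimes>\<^sub>M walk_space)"
proof -
  have "(\<lambda>p. if p \<in> frontier D then F p else 0) \<in> borel_measurable borel"
    using assms by (intro borel_measurable_continuous_on_if) (auto intro: borel_closed)
  moreover have "(\<lambda>x. heis_walk_limit D \<epsilon> (fst x) (snd x)) \<in> borel_measurable (borel \<Otimes>\<^sub>M walk_space)"
    unfolding heis_walk_limit_def by measurable
  ultimately show ?thesis
    using measurable_compose by fastforce
qed

lemma measurable_walk_value [measurable]:
  assumes "continuous_on (frontier D) F"
  shows "walk_value D F \<epsilon> \<in> borel_measurable borel"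
  unfolding walk_value_def[abs_def]
  using measurable_walk_integrand[OF assms, of \<epsilon>]
  by (intro walk.borel_measurable_lebesgue_integral) (simp add: case_prod_beta)

text \<open>The hypothesis \<open>0 \<le> B\<close> covers the default value 0 of the integrand off
  the frontier.\<close>

lemma abs_walk_value_le:
  assumes "continuous_on (frontier D) F" "0 \<le> B" "\<And>y. y \<in> frontier D \<Longrightarrow> \<bar>F y\<bar> \<le> B"
  shows "\<bar>walk_value D F \<epsilon> q\<bar> \<le> B"
proof -
  let ?f = "\<lambda>w. if heis_walk_limit D \<epsilon> q w \<in> frontier D then F (heis_walk_limit D \<epsilon> q w) else 0"
  have "?f \<in> borel_measurable walk_space"
    using measurable_compose[OF _ measurable_walk_integrand[OF assms(1), of \<epsilon>], of "\<lambda>w. (q, w)" walk_space]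
    by (simp cong: if_cong)
  then have "integrable walk_space ?f"
    using assms by (intro walk.integrable_const_bound[of _ B]) auto
  then have "\<bar>\<integral>w. ?f w \<partial>walk_space\<bar> \<le> (\<integral>w. \<bar>?f w\<bar> \<partial>walk_space)" "integrable walk_space (\<lambda>w. \<bar>?f w\<bar>)"
    by (auto intro: integral_abs_bound)
  moreover from this(2) have "(\<integral>w. \<bar>?f w\<bar> \<partial>walk_space) \<le> (\<integral>w. B \<partial>walk_space)"
    using assms by (intro integral_mono) auto
  moreover have "(\<integral>w. B \<partial>walk_space) = B"
    by (simp add: walk.prob_space)
  ultimately show ?thesis
    unfolding walk_value_def by linarith
qed

text \<open>Split off the first step, restart the walk from where it leads, and apply
  Fubini.\<close>

lemma walk_value_mean:
  assumes F: "continuous_on (frontier D) F" and "bounded D"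
  shows "walk_value D F \<epsilon> q =
    (\<integral>a. walk_value D F \<epsilon> (q \<odot> (min \<epsilon> (koranyi_setdist q (frontier D)) * fst a,
                                 min \<epsilon> (koranyi_setdist q (frontier D)) * snd a, 0)) \<partial>disc_measure)"
proof -
  interpret seq: sequence_space disc_measure
    by unfold_locales
  interpret P: pair_prob_space disc_measure walk_space
    by unfold_locales
  define G where "G p w = (if heis_walk_limit D \<epsilon> p w \<in> frontier D then F (heis_walk_limit D \<epsilon> p w) else 0)"
    for p w
  define s where "s a = q \<odot> (min \<epsilon> (koranyi_setdist q (frontier D)) * fst a,
                             min \<epsilon> (koranyi_setdist q (frontier D)) * snd a, 0)" for a
  have G: "(\<lambda>x. G (fst x) (snd x)) \<in> borel_measurable (borel \<Otimes>\<^sub>M walk_space)"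
    unfolding G_def by (rule measurable_walk_integrand[OF F])
  have Gq: "G q \<in> borel_measurable walk_space"
    using measurable_compose[OF _ G, of "\<lambda>w. (q, w)"] by simp
  have "s \<in> borel_measurable disc_measure"
    unfolding s_def by measurable
  then have Gs: "(\<lambda>(a, w). G (s a) w) \<in> borel_measurable (disc_measure \<Otimes>\<^sub>M walk_space)"
    using measurable_compose[OF _ G, of "\<lambda>x. (s (fst x), snd x)"] by (simp add: case_prod_beta)
  have G_case_nat: "G q (case_nat a w) = G (s a) w" for a w
    unfolding G_def s_def heis_walk_limit_case_nat ..
  obtain B where "0 \<le> B" "\<And>y. y \<in> frontier D \<Longrightarrow> \<bar>F y\<bar> \<le> B"
    using continuous_on_frontier_bound[OF assms(2,1)] by blast
  then have int: "integrable (disc_measure \<Otimes>\<^sub>M walk_space) (\<lambda>(a, w). G (s a) w)"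
    using Gs by (intro P.integrable_const_bound[of _ B]) (auto simp: G_def case_prod_beta)
  have "walk_value D F \<epsilon> q = (\<integral>w. G q w \<partial>walk_space)"
    by (simp add: walk_value_def G_def)
  \<comment> \<open>An independent step put in front of a sequence of independent steps yields the
    same product measure.\<close>
  also have "\<dots> = (\<integral>w. G q w \<partial>distr (disc_measure \<Otimes>\<^sub>M walk_space) walk_space (\<lambda>(a, w). case_nat a w))"
    by (simp add: walk_space_def seq.PiM_iter)
  also have "\<dots> = (\<integral>(a, w). G (s a) w \<partial>(disc_measure \<Otimes>\<^sub>M walk_space))"
    using Gq by (subst integral_distr) (auto simp: walk_space_def case_prod_beta' G_case_nat)
  also have "\<dots> = (\<integral>a. \<integral>w. G (s a) w \<partial>walk_space \<partial>disc_measure)"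
    using P.integral_fst'[OF int] by simp
  finally show ?thesis
    by (simp add: walk_value_def G_def s_def)
qed

section \<open>Maximum principle with a barrier\<close>

text \<open>The set \<open>E\<close> plays the role of a boundary layer. Outside it the average of
  \<open>h = g + \<kappa> * \<phi>\<close> over one step exceeds \<open>h\<close> by at least
  \<open>\<kappa> * \<gamma>\<close>, so a point where \<open>h\<close> is within that amount of its
  supremum must lie in \<open>E\<close>. The supremum need not be attained.\<close>

lemma (in prob_space) maximum_principle_barrier:
  fixes g \<phi> :: "'b \<Rightarrow> real" and step :: "'b \<Rightarrow> 'a \<Rightarrow> 'b"
  assumes g_bound: "\<And>p. p \<in> A \<Longrightarrow> g p \<le> B"
    and \<phi>_bound: "\<And>p. p \<in> A \<Longrightarrow> 0 \<le> \<phi> p" "\<And>p. p \<in> A \<Longrightarrow> \<phi> p \<le> K"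
    and "0 < \<gamma>"
    and step: "\<And>p a. p \<in> A \<Longrightarrow> p \<notin> E \<Longrightarrow> a \<in> space M \<Longrightarrow> step p a \<in> A"
    and g_int: "\<And>p. p \<in> A \<Longrightarrow> p \<notin> E \<Longrightarrow> integrable M (\<lambda>a. g (step p a))"
    and \<phi>_int: "\<And>p. p \<in> A \<Longrightarrow> p \<notin> E \<Longrightarrow> integrable M (\<lambda>a. \<phi> (step p a))"
    and g_mean: "\<And>p. p \<in> A \<Longrightarrow> p \<notin> E \<Longrightarrow> g p \<le> (\<integral>a. g (step p a) \<partial>M)"
    and \<phi>_mean: "\<And>p. p \<in> A \<Longrightarrow> p \<notin> E \<Longrightarrow> \<phi> p + \<gamma> \<le> (\<integral>a. \<phi> (step p a) \<partial>M)"
    and boundary: "\<And>p. p \<in> A \<Longrightarrow> p \<in> E \<Longrightarrow> g p \<le> \<eta>"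
    and "q \<in> A"
  shows "g q \<le> \<eta>"
proof (rule field_le_epsilon)
  fix e :: real assume "0 < e"
  have "0 \<le> K"
    using \<phi>_bound[OF \<open>q \<in> A\<close>] by linarith
  \<comment> \<open>The total error is at most \<open>\<kappa> * K\<close> from the barrier on
    \<open>E\<close> plus \<open>\<kappa> * \<gamma>\<close> from missing the supremum.\<close>
  define \<kappa> where "\<kappa> = e / (K + \<gamma>)"
  have \<kappa>: "0 < \<kappa>" "\<kappa> * (K + \<gamma>) = e"
    using \<open>0 < e\<close> \<open>0 \<le> K\<close> \<open>0 < \<gamma>\<close> by (auto simp: \<kappa>_def)
  define h where "h p = g p + \<kappa> * \<phi> p" for p
  have "h p \<le> B + \<kappa> * K" if "p \<in> A" for p
    using g_bound[OF that] \<phi>_bound(2)[OF that] \<kappa>(1) by (simp add: h_def add_mono)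
  then have bdd: "bdd_above (h ` A)"
    by (rule bdd_aboveI2)
  let ?s = "SUP p\<in>A. h p"
  have "?s - \<kappa> * \<gamma> < ?s"
    using \<kappa>(1) \<open>0 < \<gamma>\<close> by simp
  then obtain p where p: "p \<in> A" "?s - \<kappa> * \<gamma> < h p"
    using less_cSUP_iff[OF _ bdd] \<open>q \<in> A\<close> by blast
  have "p \<in> E"
  proof (rule ccontr)
    assume "p \<notin> E"
    note int = g_int[OF p(1) this] \<phi>_int[OF p(1) this]
    have "h p + \<kappa> * \<gamma> = g p + \<kappa> * (\<phi> p + \<gamma>)"
      by (simp add: h_def algebra_simps)
    also have "\<dots> \<le> (\<integral>a. g (step p a) \<partial>M) + \<kappa> * (\<integral>a. \<phi> (step p a) \<partial>M)"
      using g_mean[OF p(1) \<open>p \<notin> E\<close>] \<phi>_mean[OF p(1) \<open>p \<notin> E\<close>] \<kappa>(1)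
      by (intro add_mono mult_left_mono) auto
    also have "\<dots> = (\<integral>a. h (step p a) \<partial>M)"
      using int by (simp add: h_def)
    also have "\<dots> \<le> (\<integral>a. ?s \<partial>M)"
      using int cSUP_upper[OF step[OF p(1) \<open>p \<notin> E\<close>] bdd]
      by (intro integral_mono) (auto simp: h_def)
    finally show False
      using p(2) by (simp add: prob_space)
  qed
  with boundary[OF p(1)] \<phi>_bound(2)[OF p(1)] \<kappa>(1) have "h p \<le> \<eta> + \<kappa> * K"
    by (simp add: h_def add_mono)
  with p(2) \<kappa>(2) have "?s \<le> \<eta> + e"
    by (simp add: algebra_simps)
  moreover have "h q \<le> ?s"
    by (rule cSUP_upper[OF \<open>q \<in> A\<close> bdd])
  moreover have "g q \<le> h q"
    using \<phi>_bound(1)[OF \<open>q \<in> A\<close>] \<kappa>(1) by (simp add: h_def)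
  ultimately show "g q \<le> \<eta> + e" by linarith
qed

section \<open>Uniform displacement estimates from compactness\<close>

text \<open>Uniform continuity of the group law on a compact set, compared with the zero step, which
  fixes \<open>p\<close>.\<close>

lemma small_step_displacement:
  assumes "bounded D" "0 < \<rho>"
  obtains \<epsilon>\<^sub>1 where "0 < \<epsilon>\<^sub>1"
    "\<And>p x y. p \<in> D \<Longrightarrow> norm (x, y) < \<epsilon>\<^sub>1 \<Longrightarrow> dist (p \<odot> (x, y, 0)) p < \<rho>"
proof -
  let ?K = "closure D \<times> cball (0 :: real \<times> real) 1"
  let ?f = "\<lambda>x. fst x \<odot> (fst (snd x), snd (snd x), 0)"
  have "uniformly_continuous_on ?K ?f"
    using assms
    by (intro compact_uniformly_continuous continuous_intros compact_Times) auto
  then obtain d where "0 < d"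
    and d: "\<And>u v. u \<in> ?K \<Longrightarrow> v \<in> ?K \<Longrightarrow> dist v u < d \<Longrightarrow> dist (?f v) (?f u) < \<rho>"
    using \<open>0 < \<rho>\<close> by (rule uniformly_continuous_onE) blast
  show ?thesis
  \<comment> \<open>The cap 1 keeps the step in the compact unit disc.\<close>
  proof (rule that[of "min d 1"])
    fix p :: heis and x y :: real assume *: "p \<in> D" "norm (x, y) < min d 1"
    then have "p \<in> closure D"
      using closure_subset by blast
    moreover have "dist (p, x, y) (p, 0) = norm (x, y)"
      by (simp add: dist_Pair_Pair)
    moreover have "dist (0, 0) (x, y) = norm (x, y)"
      by (simp add: norm_Pair dist_Pair_Pair)
    ultimately show "dist (p \<odot> (x, y, 0)) p < \<rho>"
      using d[of "(p, 0)" "(p, x, y)"] * heis_mult_zero(2)[of p]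
      by (simp add: zero_prod_def del: heis_mult.simps heis_mult_zero)
  qed (use \<open>0 < d\<close> in auto)
qed

text \<open>For \<open>q' = q\<close> the translation is the identity; uniform continuity on the
  compact cube of \<open>closure D\<close> makes nearby translations move all points of
  \<open>D\<close> little.\<close>

lemma small_translation_displacement:
  assumes "bounded D" "0 < \<rho>"
  obtains \<delta>\<^sub>1 where "0 < \<delta>\<^sub>1"
    "\<And>p q q'. p \<in> D \<Longrightarrow> q \<in> D \<Longrightarrow> q' \<in> D \<Longrightarrow> dist q' q < \<delta>\<^sub>1 \<Longrightarrow>
       dist (q' \<odot> heis_inv q \<odot> p) p < \<rho>"
proof -
  let ?K = "closure D \<times> closure D \<times> closure D"
  let ?f = "\<lambda>x. fst x \<odot> (heis_inv (fst (snd x)) \<odot> snd (snd x))"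
  have "uniformly_continuous_on ?K ?f"
    using assms unfolding heis_inv_conv
    by (intro compact_uniformly_continuous continuous_intros compact_Times) auto
  then obtain d where "0 < d"
    and d: "\<And>u v. u \<in> ?K \<Longrightarrow> v \<in> ?K \<Longrightarrow> dist v u < d \<Longrightarrow> dist (?f v) (?f u) < \<rho>"
    using \<open>0 < \<rho>\<close> by (rule uniformly_continuous_onE) blast
  show ?thesis
  proof (rule that[OF \<open>0 < d\<close>])
    fix p q q' assume *: "p \<in> D" "q \<in> D" "q' \<in> D" "dist q' q < d"
    then have "p \<in> closure D" "q \<in> closure D" "q' \<in> closure D"
      using closure_subset by blast+
    moreover have "q \<odot> (heis_inv q \<odot> p) = p"
      by (simp flip: heis_mult_assoc)
    ultimately show "dist (q' \<odot> heis_inv q \<odot> p) p < \<rho>"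
      using d[of "(q, q, p)" "(q', q, p)"] * by (simp add: dist_Pair_Pair heis_mult_assoc)
  qed
qed

text \<open>Uniform continuity loses at most half of the distance to each frontier point. Hence the
  Euclidean ball around \<open>p\<close> misses the frontier and, being connected and meeting
  \<open>D\<close>, lies in \<open>D\<close>.\<close>

lemma ball_inside_away_from_frontier:
  fixes D :: "heis set"
  assumes "bounded D" "frontier D \<noteq> {}" "0 < \<delta>"
  obtains \<rho> where "0 < \<rho>"
    "\<And>p x. p \<in> D \<Longrightarrow> \<delta> \<le> koranyi_setdist p (frontier D) \<Longrightarrow> dist x p < \<rho> \<Longrightarrow>
       x \<in> D \<and> \<delta> / 2 \<le> koranyi_setdist x (frontier D)"
proof -
  obtain R where R: "\<And>p. p \<in> D \<Longrightarrow> norm p \<le> R"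
    using assms(1) by (auto simp: bounded_iff)
  let ?K = "cball (0 :: heis) (R + 1) \<times> frontier D"
  let ?f = "\<lambda>x. koranyi_dist (fst x) (snd x)"
  have "uniformly_continuous_on ?K ?f"
    using assms
    by (intro compact_uniformly_continuous continuous_intros compact_Times compact_frontier_bounded) auto
  moreover have "0 < \<delta> / 2"
    using \<open>0 < \<delta>\<close> by simp
  ultimately obtain d where "0 < d"
    and d: "\<And>u v. u \<in> ?K \<Longrightarrow> v \<in> ?K \<Longrightarrow> dist v u < d \<Longrightarrow> dist (?f v) (?f u) < \<delta> / 2"
    by (rule uniformly_continuous_onE) blast
  \<comment> \<open>The cap 1 keeps points near \<open>D\<close> in the ball of radius
    \<open>R + 1\<close>.\<close>
  define \<rho> where "\<rho> = min d 1"
  have "0 < \<rho>"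
    using \<open>0 < d\<close> by (simp add: \<rho>_def)
  moreover have "x \<in> D \<and> \<delta> / 2 \<le> koranyi_setdist x (frontier D)"
    if p: "p \<in> D" "\<delta> \<le> koranyi_setdist p (frontier D)" and x: "dist x p < \<rho>" for p x
  proof
    have far: "\<delta> / 2 \<le> koranyi_dist z y" if z: "dist z p < \<rho>" and y: "y \<in> frontier D" for z y
    proof -
      have "norm p \<le> R"
        by (rule R[OF p(1)])
      moreover have "norm z \<le> norm p + dist z p"
        by (metis dist_norm norm_triangle_sub)
      ultimately have "p \<in> cball 0 (R + 1)" "z \<in> cball 0 (R + 1)"
        using z by (auto simp: \<rho>_def)
      then have "\<bar>koranyi_dist z y - koranyi_dist p y\<bar> < \<delta> / 2"
        using d[of "(p, y)" "(z, y)"] y z by (simp add: dist_Pair_Pair dist_real_def \<rho>_def)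
      moreover have "\<delta> \<le> koranyi_dist p y"
        using p(2) koranyi_setdist_le[OF y, of p] by linarith
      ultimately show ?thesis by linarith
    qed
    show "\<delta> / 2 \<le> koranyi_setdist x (frontier D)"
      using far[OF x] by (intro koranyi_setdist_greatest assms(2))
    have "ball p \<rho> \<inter> frontier D = {}"
    proof (rule ccontr)
      assume "ball p \<rho> \<inter> frontier D \<noteq> {}"
      then obtain z where "dist z p < \<rho>" "z \<in> frontier D"
        by (auto simp: dist_commute)
      \<comment> \<open>Used with \<open>y = z\<close>: the distance of \<open>z\<close> to itself
        would be positive.\<close>
      from far[OF this] show False
        using \<open>0 < \<delta>\<close> by simp
    qed
    moreover have "p \<in> ball p \<rho> \<inter> D"
      using \<open>0 < \<rho>\<close> p(1) by simp
    ultimately have "ball p \<rho> \<subseteq> D"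
      using connected_Int_frontier[of "ball p \<rho>" D] by blast
    then show "x \<in> D"
      using x by (auto simp: dist_commute)
  qed
  ultimately show ?thesis
    by (rule that)
qed

section \<open>The quadratic barrier\<close>

text \<open>Expanding the square, the second-order term contributes
  \<open>\<epsilon>\<^sup>2\<close> times the second moment, which serves as
  \<open>\<gamma>\<close>. Here \<open>x\<close> is the first coordinate of a point, to which a full
  step simply adds \<open>\<epsilon> * fst a\<close>.\<close>

lemma square_barrier:
  assumes "0 < \<epsilon>"
  obtains s \<gamma> where "0 < \<gamma>"
    "\<And>x. \<bar>x\<bar> \<le> R \<Longrightarrow> (x + s)\<^sup>2 + \<gamma> \<le> (\<integral>a. (x + \<epsilon> * fst a + s)\<^sup>2 \<partial>disc_measure)"
proof -
  let ?m = "\<integral>a. fst a \<partial>disc_measure" and ?v = "\<integral>a. (fst a)\<^sup>2 \<partial>disc_measure"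
  have int: "integrable disc_measure fst" "integrable disc_measure (\<lambda>a. (fst a)\<^sup>2)"
    using abs_fst_disc_less
    by (auto intro!: integrable_disc_bounded[of _ 1] simp: abs_square_le_1 less_imp_le)
  \<comment> \<open>The sign of \<open>s\<close> makes the linear term nonnegative, so the mean step need not be computed.\<close>
  define s where "s = (if 0 \<le> ?m then R else - R)"
  show ?thesis
  proof (rule that[of "\<epsilon>\<^sup>2 * ?v" s])
    show "0 < \<epsilon>\<^sup>2 * ?v"
      using assms integral_disc_fst_square_pos by simp
    fix x :: real assume "\<bar>x\<bar> \<le> R"
    then have "0 \<le> (x + s) * ?m"
      by (auto simp: s_def zero_le_mult_iff)
    then have "0 \<le> 2 * \<epsilon> * ((x + s) * ?m)"
      using assms by simp
    moreover have "(x + \<epsilon> * fst a + s)\<^sup>2 = (x + s)\<^sup>2 + 2 * \<epsilon> * (x + s) * fst a + \<epsilon>\<^sup>2 * (fst a)\<^sup>2"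
      for a :: "real \<times> real"
      by (simp add: power2_eq_square algebra_simps)
    ultimately show "(x + s)\<^sup>2 + \<epsilon>\<^sup>2 * ?v \<le> (\<integral>a. (x + \<epsilon> * fst a + s)\<^sup>2 \<partial>disc_measure)"
      using int by (simp add: disc.prob_space algebra_simps)
  qed
qed

section \<open>Comparison of the values at a point and at its left translate\<close>

theorem lemma7p1:
  fixes D :: "heis set" and F :: "heis \<Rightarrow> real"
  assumes "open D" and "bounded D" and "connected D"
    and "continuous_on (frontier D) F"
    and "\<forall>\<eta>>0. \<exists>\<delta>>0. \<exists>\<epsilon>\<^sub>0>0. \<forall>\<epsilon>\<in>{0<..<\<epsilon>\<^sub>0} \<inter> {0<..<1}. \<forall>q\<in>D. \<forall>q'\<in>D.
           koranyi_setdist q (frontier D) < \<delta> \<and> norm (q - q') \<le> \<delta> \<longrightarrow>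
             \<bar>walk_value D F \<epsilon> q' - walk_value D F \<epsilon> q\<bar> \<le> \<eta>"
  shows "\<forall>\<eta>>0. \<exists>\<delta>>0. \<exists>\<epsilon>\<^sub>0>0. \<forall>\<epsilon>\<in>{0<..<\<epsilon>\<^sub>0} \<inter> {0<..<1}. \<forall>q\<in>D. \<forall>q'\<in>D.
           norm (q - q') \<le> \<delta> \<longrightarrow>
             \<bar>walk_value D F \<epsilon> q' - walk_value D F \<epsilon> q\<bar> \<le> \<eta>"
proof (intro allI impI)
  fix \<eta> :: real assume "0 < \<eta>"
  show "\<exists>\<delta>>0. \<exists>\<epsilon>\<^sub>0>0. \<forall>\<epsilon>\<in>{0<..<\<epsilon>\<^sub>0} \<inter> {0<..<1}. \<forall>q\<in>D. \<forall>q'\<in>D.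
           norm (q - q') \<le> \<delta> \<longrightarrow> \<bar>walk_value D F \<epsilon> q' - walk_value D F \<epsilon> q\<bar> \<le> \<eta>"
  proof (cases "D = {}")
    case False
    have fr: "frontier D \<noteq> {}"
      using False \<open>bounded D\<close> frontier_eq_empty not_bounded_UNIV by blast
    obtain \<delta> \<epsilon>\<^sub>0 where "0 < \<delta>" "0 < \<epsilon>\<^sub>0"
      and near: "\<And>\<epsilon> q q'. \<lbrakk>0 < \<epsilon>; \<epsilon> < \<epsilon>\<^sub>0; \<epsilon> < 1; q \<in> D; q' \<in> D;
        koranyi_setdist q (frontier D) < \<delta>; norm (q - q') \<le> \<delta>\<rbrakk> \<Longrightarrow>
        \<bar>walk_value D F \<epsilon> q' - walk_value D F \<epsilon> q\<bar> \<le> \<eta>"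
      using assms(5) \<open>0 < \<eta>\<close> by fastforce
    obtain \<rho> where "0 < \<rho>"
      and \<rho>: "\<And>p x. p \<in> D \<Longrightarrow> \<delta> \<le> koranyi_setdist p (frontier D) \<Longrightarrow> dist x p < \<rho> \<Longrightarrow>
        x \<in> D \<and> \<delta> / 2 \<le> koranyi_setdist x (frontier D)"
      using ball_inside_away_from_frontier[OF \<open>bounded D\<close> fr \<open>0 < \<delta>\<close>] by metis
    obtain \<epsilon>\<^sub>1 where "0 < \<epsilon>\<^sub>1"
      and \<epsilon>\<^sub>1: "\<And>p x y. p \<in> D \<Longrightarrow> norm (x, y) < \<epsilon>\<^sub>1 \<Longrightarrow> dist (p \<odot> (x, y, 0)) p < \<rho> / 2"
      using small_step_displacement[OF \<open>bounded D\<close>, of "\<rho> / 2"] \<open>0 < \<rho>\<close> half_gt_zero by metis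
    \<comment> \<open>The bound \<open>\<delta>\<close> lets the hypothesis compare a point near the
      frontier with its translate; \<open>\<rho> / 2\<close> leaves room for a step of displacement
      below \<open>\<rho> / 2\<close>.\<close>
    have "0 < min \<delta> (\<rho> / 2)"
      using \<open>0 < \<delta>\<close> \<open>0 < \<rho>\<close> by simp
    then obtain \<delta>\<^sub>1 where "0 < \<delta>\<^sub>1"
      and \<delta>\<^sub>1: "\<And>p q q'. p \<in> D \<Longrightarrow> q \<in> D \<Longrightarrow> q' \<in> D \<Longrightarrow> dist q' q < \<delta>\<^sub>1 \<Longrightarrow>
        dist (q' \<odot> heis_inv q \<odot> p) p < min \<delta> (\<rho> / 2)"
      using small_translation_displacement[OF \<open>bounded D\<close>] by metis
    obtain R where R: "\<And>p. p \<in> D \<Longrightarrow> norm p \<le> R"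
      using \<open>bounded D\<close> by (auto simp: bounded_iff)
    obtain B where B: "0 \<le> B" "\<And>y. y \<in> frontier D \<Longrightarrow> \<bar>F y\<bar> \<le> B"
      using continuous_on_frontier_bound[OF \<open>bounded D\<close> assms(4)] by blast
    \<comment> \<open>The condition \<open>\<epsilon> < \<delta> / 2\<close> makes the step radius
      equal to \<open>\<epsilon>\<close> wherever the distance to the frontier is at least
      \<open>\<delta> / 2\<close>.\<close>
    have main: "\<bar>walk_value D F \<epsilon> q' - walk_value D F \<epsilon> q\<bar> \<le> \<eta>"
      if \<epsilon>: "0 < \<epsilon>" "\<epsilon> < \<epsilon>\<^sub>0" "\<epsilon> < 1" "\<epsilon> < \<epsilon>\<^sub>1" "\<epsilon> < \<delta> / 2"
        and q: "q \<in> D" "q' \<in> D" "dist q' q < \<delta>\<^sub>1" for \<epsilon> q q'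
    proof -
      define c where "c = q' \<odot> heis_inv q"
      have c: "dist (c \<odot> p) p < min \<delta> (\<rho> / 2)" if "p \<in> D" for p
        unfolding c_def using \<delta>\<^sub>1 q that by blast
      define u where "u = walk_value D F \<epsilon>"
      \<comment> \<open>The absolute value handles both signs at once; it only turns the mean value
        identity into the inequality that the maximum principle asks for.\<close>
      define g where "g p = \<bar>u (c \<odot> p) - u p\<bar>" for p
      define A where "A = {p \<in> D. c \<odot> p \<in> D}"
      define E where "E = {p. koranyi_setdist p (frontier D) < \<delta>}"
      define step where "step p a = p \<odot> (\<epsilon> * fst a, \<epsilon> * snd a, 0)" for p a
      have u_meas [measurable]: "u \<in> borel_measurable borel"
        unfolding u_def by (rule measurable_walk_value[OF assms(4)])
      have u_bound: "\<bar>u p\<bar> \<le> B" for p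
        unfolding u_def by (rule abs_walk_value_le[OF assms(4) B])
      have step_meas [measurable]: "step p \<in> borel_measurable disc_measure" for p
        unfolding step_def by measurable
      have u_int: "integrable disc_measure (\<lambda>a. u (step p a))" for p
        by (intro integrable_disc_bounded[of _ B] u_bound) measurable
      have u_mean: "u p = (\<integral>a. u (step p a) \<partial>disc_measure)" if "\<delta> / 2 \<le> koranyi_setdist p (frontier D)" for p
      proof -
        have "min \<epsilon> (koranyi_setdist p (frontier D)) = \<epsilon>"
          using that \<epsilon> by simp
        then show ?thesis
          using walk_value_mean[OF assms(4,2), of \<epsilon> p] by (simp add: u_def step_def)
      qed
      \<comment> \<open>This is the coupling: steps multiply on the right, so they commute with left
        translation.\<close>
      have c_step: "c \<odot> step p a = step (c \<odot> p) a" for p a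
        by (simp add: step_def heis_mult_assoc)
      obtain s \<gamma> where "0 < \<gamma>" and barrier:
        "\<And>x. \<bar>x\<bar> \<le> R \<Longrightarrow> (x + s)\<^sup>2 + \<gamma> \<le> (\<integral>a. (x + \<epsilon> * fst a + s)\<^sup>2 \<partial>disc_measure)"
        using square_barrier[OF \<epsilon>(1)] by metis
      define \<phi> where "\<phi> p = (fst p + s)\<^sup>2" for p :: heis
      have fst_bound: "\<bar>fst p\<bar> \<le> R" if "p \<in> D" for p
        using R[OF that] norm_fst_le[of "fst p" "snd p"] by simp
      have \<phi>_step: "\<phi> (step p a) = (fst p + \<epsilon> * fst a + s)\<^sup>2" for p a
        by (simp add: \<phi>_def step_def heis_mult_conv)
      have \<phi>_bound: "\<phi> p \<le> (R + \<bar>s\<bar>)\<^sup>2" if "p \<in> D" for p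
        unfolding \<phi>_def using fst_bound[OF that] by (intro abs_le_square_iff[THEN iffD1]) linarith
      have interior: "step p a \<in> A" if p: "p \<in> A" "p \<notin> E" and a: "a \<in> space disc_measure" for p a
      proof -
        have p': "p \<in> D" "\<delta> \<le> koranyi_setdist p (frontier D)"
          using p by (auto simp: A_def E_def)
        have "norm (\<epsilon> * fst a, \<epsilon> * snd a) = \<epsilon> * norm a"
          using \<epsilon>(1) norm_scaleR[of \<epsilon> a] by (cases a) (simp add: scaleR_prod_def)
        also have "\<dots> < \<epsilon>\<^sub>1"
          using mult_strict_left_mono[OF norm_disc_less[OF a] \<epsilon>(1)] \<epsilon>(4) by simp
        finally have 1: "dist (step p a) p < \<rho> / 2"
          unfolding step_def by (rule \<epsilon>\<^sub>1[OF p'(1)])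
        then have 2: "step p a \<in> D"
          using \<rho>[OF p'] \<open>0 < \<rho>\<close> by simp
        \<comment> \<open>The estimate \<open>c\<close> applies because the new position is already
          known to lie in \<open>D\<close>.\<close>
        have "dist (c \<odot> step p a) p < \<rho>"
          using c[OF 2] 1 dist_triangle[of "c \<odot> step p a" p "step p a"] by simp
        then have "c \<odot> step p a \<in> D"
          using \<rho>[OF p'] by simp
        with 2 show ?thesis by (simp add: A_def)
      qed
      have "g q \<le> \<eta>"
      proof (rule disc.maximum_principle_barrier[where A = A and E = E and step = step and \<phi> = \<phi>
            and B = "2 * B" and K = "(R + \<bar>s\<bar>)\<^sup>2" and \<gamma> = \<gamma>])
        show "g p \<le> 2 * B" for p
          using u_bound[of p] u_bound[of "c \<odot> p"] by (simp add: g_def)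
        show "0 \<le> \<phi> p" for p
          by (simp add: \<phi>_def)
        show "\<phi> p \<le> (R + \<bar>s\<bar>)\<^sup>2" if "p \<in> A" for p
          using \<phi>_bound that by (simp add: A_def)
        show "0 < \<gamma>" by fact
        show "step p a \<in> A" if "p \<in> A" "p \<notin> E" "a \<in> space disc_measure" for p a
          using interior that .
        show "integrable disc_measure (\<lambda>a. g (step p a))" for p
          unfolding g_def c_step using u_int by auto
        show "integrable disc_measure (\<lambda>a. \<phi> (step p a))" if "p \<in> A" "p \<notin> E" for p
        proof (rule integrable_disc_bounded)
          show "(\<lambda>a. \<phi> (step p a)) \<in> borel_measurable disc_measure"
            unfolding \<phi>_step by measurable
          show "\<bar>\<phi> (step p a)\<bar> \<le> (R + \<bar>s\<bar>)\<^sup>2" if "a \<in> space disc_measure" for a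
            using \<phi>_bound[of "step p a"] interior[OF \<open>p \<in> A\<close> \<open>p \<notin> E\<close> that] by (simp add: A_def \<phi>_def)
        qed
        show "g p \<le> (\<integral>a. g (step p a) \<partial>disc_measure)" if p: "p \<in> A" "p \<notin> E" for p
        proof -
          have p': "p \<in> D" "\<delta> \<le> koranyi_setdist p (frontier D)"
            using p by (auto simp: A_def E_def)
          \<comment> \<open>So both \<open>p\<close> and its translate take steps of the full radius
            \<open>\<epsilon>\<close>.\<close>
          have "\<delta> / 2 \<le> koranyi_setdist (c \<odot> p) (frontier D)"
            using \<rho>[OF p', of "c \<odot> p"] c[OF p'(1)] \<open>0 < \<rho>\<close> by simp
          then have "u (c \<odot> p) - u p = (\<integral>a. u (step (c \<odot> p) a) - u (step p a) \<partial>disc_measure)"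
            using u_mean[of p] u_mean[of "c \<odot> p"] p'(2) \<open>0 < \<delta>\<close> u_int by simp
          then show ?thesis
            unfolding g_def c_step by (simp add: integral_abs_bound)
        qed
        show "\<phi> p + \<gamma> \<le> (\<integral>a. \<phi> (step p a) \<partial>disc_measure)" if "p \<in> A" for p
          using barrier[OF fst_bound] that unfolding \<phi>_step by (simp add: \<phi>_def A_def)
        show "g p \<le> \<eta>" if "p \<in> A" "p \<in> E" for p
        proof -
          have "norm (p - c \<odot> p) \<le> \<delta>"
            using c[of p] that by (simp add: A_def dist_norm norm_minus_commute)
          then show ?thesis
            using near[OF \<epsilon>(1-3), of p "c \<odot> p"] that by (simp add: A_def E_def g_def u_def)
        qed
        show "q \<in> A"
          using q by (simp add: A_def c_def heis_mult_assoc)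
      qed
      then show ?thesis
        by (simp add: g_def u_def c_def heis_mult_assoc)
    qed
    show ?thesis
    proof (intro exI conjI ballI impI)
      \<comment> \<open>Halving turns the non-strict bound on the distance into the strict one
        required by \<open>main\<close>.\<close>
      show "0 < \<delta>\<^sub>1 / 2" "0 < min \<epsilon>\<^sub>0 (min \<epsilon>\<^sub>1 (\<delta> / 2))"
        using \<open>0 < \<delta>\<^sub>1\<close> \<open>0 < \<epsilon>\<^sub>0\<close> \<open>0 < \<epsilon>\<^sub>1\<close> \<open>0 < \<delta>\<close> by auto
      fix \<epsilon> q q' assume *: "\<epsilon> \<in> {0<..<min \<epsilon>\<^sub>0 (min \<epsilon>\<^sub>1 (\<delta> / 2))} \<inter> {0<..<1}" "q \<in> D" "q' \<in> D"
        "norm (q - q') \<le> \<delta>\<^sub>1 / 2"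
      then have "dist q' q < \<delta>\<^sub>1"
        using \<open>0 < \<delta>\<^sub>1\<close> by (simp add: dist_norm norm_minus_commute)
      with * show "\<bar>walk_value D F \<epsilon> q' - walk_value D F \<epsilon> q\<bar> \<le> \<eta>"
        by (intro main) auto
    qed
  qed (use zero_less_one in blast)
qed

end
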